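(* Let $m\geq 2$ be an integer, let $0<\rho\leq\infty$ and $I=(0,\rho)$, and suppose $f\in C^{2m}(I)$ is real-valued and satisfies $f\geq 0$, $f'\geq 0$ and $f''\geq 0$ on $I$. If $\mathcal{H}_{m+1}(f;x)\succeq 0$ for all $x\in I$, then $\mathcal{H}_m(f';x)\succeq 0$ for all $x\in I$.
   Context: $\mathcal{E}:=x\frac{d}{dx}$ is the Euler derivative, i.e. $(\mathcal{E}f)(x)=xf'(x)$, and $\mathcal{E}^k$ is its $k$-fold iterate ($\mathcal{E}^0f=f$). The Euler--Hankel matrix is $\mathcal{H}_n(f;x):=[\mathcal{E}^{i+j}f(x)]_{i,j=0}^{n-1}$. $\succeq 0$ means positive semidefinite. *)

theory Defs
  imports "HOL-Analysis.Analysis" "Jordan_Normal_Form.Matrix"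
begin

definition euler_deriv :: "(real \<Rightarrow> real) \<Rightarrow> real \<Rightarrow> real" where
  "euler_deriv f = (\<lambda>x. x * deriv f x)"

definition euler_hankel :: "nat \<Rightarrow> (real \<Rightarrow> real) \<Rightarrow> real \<Rightarrow> real Matrix.mat" where
  "euler_hankel n f x = Matrix.mat n n (\<lambda>(i, j). (euler_deriv ^^ (i + j)) f x)"

(* The equation forces A to be square. *)
definition pos_semidef :: "real Matrix.mat \<Rightarrow> bool" where
  "pos_semidef A \<longleftrightarrow> transpose_mat A = A \<and>
     (\<forall>v \<in> carrier_vec (dim_row A). 0 \<le> scalar_prod v (A *\<^sub>v v))"

(* Intended for open S: derivatives are two-sided and taken at the points of S, so
   the values of f outside S play no role. *)
definition C_k_on :: "nat \<Rightarrow> (real \<Rightarrow> real) \<Rightarrow> real set \<Rightarrow> bool" where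
  "C_k_on k f S \<longleftrightarrow>
     (\<forall>i<k. \<forall>x\<in>S. (deriv ^^ i) f field_differentiable (at x)) \<and>
     continuous_on S ((deriv ^^ k) f)"

end

theory Submission
  imports Defs "HOL-Computational_Algebra.Polynomial"
begin

text \<open>
  In the variable \<open>t = ln x\<close> the Euler derivative becomes \<open>D = d/dt\<close>, and the domain becomes a
  half-line unbounded to the left. With \<open>g t = f (exp t)\<close>, the hypothesis says
  \<open>p(D)\<^sup>2 g \<ge> 0\<close> for all real polynomials \<open>p\<close> of degree at most \<open>m\<close>, and since
  \<open>f' = exp (- t) * D g\<close>, the conclusion is, after the substitution \<open>D \<mapsto> D - 1\<close>, that
  \<open>D p(D)\<^sup>2 g \<ge> 0\<close> for \<open>p\<close> of degree less than \<open>m\<close>. Even derivatives of \<open>g\<close> are nonnegative;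
  inductively so are the odd ones, since a negative odd derivative would force linear growth of
  the preceding one, hence unboundedness below of the one before that, as \<open>t \<rightarrow> -\<infinity>\<close>. So all
  derivatives of \<open>g\<close> of order less than \<open>2 m\<close> are bounded near \<open>-\<infinity>\<close>, and so is
  \<open>u = p(D)\<^sup>2 g\<close>. As \<open>u'' = (D p(D))\<^sup>2 g \<ge> 0\<close>, \<open>u\<close> is convex and bounded near \<open>-\<infinity>\<close>, so
  \<open>u' \<ge> 0\<close>.
\<close>

section \<open>Polynomials in the differential operator\<close>

text \<open>With \<open>a k = (D ^ k) g t\<close> this is the value of \<open>q(D) g\<close> at \<open>t\<close>.\<close>

definition coeff_functional :: "(nat \<Rightarrow> real) \<Rightarrow> real poly \<Rightarrow> real" where
  "coeff_functional a q = (\<Sum>k\<le>degree q. coeff q k * a k)"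

lemma coeff_functional_eq_sum:
  assumes "degree q \<le> n"
  shows "coeff_functional a q = (\<Sum>k\<le>n. coeff q k * a k)"
  unfolding coeff_functional_def
  by (rule sum.mono_neutral_left) (use assms coeff_eq_0 in \<open>auto simp: not_le\<close>)

lemma coeff_functional_0 [simp]: "coeff_functional a 0 = 0"
  by (simp add: coeff_functional_def)

lemma coeff_functional_add:
  "coeff_functional a (p + q) = coeff_functional a p + coeff_functional a q"
proof -
  have "degree (p + q) \<le> max (degree p) (degree q)"
    by (rule degree_add_le_max)
  then show ?thesis
    by (subst (1 2 3) coeff_functional_eq_sum[where n = "max (degree p) (degree q)"])
       (auto simp: algebra_simps sum.distrib)
qed

lemma coeff_functional_smult:
  "coeff_functional a (Polynomial.smult c p) = c * coeff_functional a p"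
  by (subst (1 2) coeff_functional_eq_sum[where n = "degree p"])
     (auto simp: sum_distrib_left mult_ac degree_smult_le)

lemma coeff_functional_diff:
  "coeff_functional a (p - q) = coeff_functional a p - coeff_functional a q"
  using coeff_functional_add[of a p "- q"] coeff_functional_smult[of a "-1" q] by simp

lemma coeff_functional_sum:
  "coeff_functional a (\<Sum>i\<in>A. p i) = (\<Sum>i\<in>A. coeff_functional a (p i))"
  by (induction A rule: infinite_finite_induct) (auto simp: coeff_functional_add)

text \<open>Multiplying by the indeterminate amounts to one more differentiation, which shifts the
  sequence of derivatives.\<close>

lemma coeff_functional_pCons_0:
  "coeff_functional a (pCons 0 q) = coeff_functional (\<lambda>k. a (Suc k)) q"
proof -
  have "coeff_functional a (pCons 0 q) = (\<Sum>k\<le>Suc (degree q). coeff (pCons 0 q) k * a k)"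
    by (rule coeff_functional_eq_sum) (rule degree_pCons_le)
  also have "\<dots> = (\<Sum>k\<le>degree q. coeff q k * a (Suc k))"
    by (subst sum.atMost_Suc_shift) simp
  finally show ?thesis
    by (simp add: coeff_functional_def)
qed

lemma coeff_functional_monom [simp]: "coeff_functional a (monom c k) = c * a k"
proof -
  have "coeff_functional a (monom c k) = (\<Sum>i\<le>k. coeff (monom c k) i * a i)"
    by (rule coeff_functional_eq_sum) (rule degree_monom_le)
  also have "\<dots> = (\<Sum>i\<le>k. if i = k then c * a i else 0)"
    by (intro sum.cong) auto
  finally show ?thesis
    by simp
qed

lemma has_derivative_coeff_functional:
  assumes "\<And>k. k \<le> degree q \<Longrightarrow> ((\<lambda>t. G k t) has_real_derivative D k) (at t)"
  shows "((\<lambda>t. coeff_functional (\<lambda>k. G k t) q) has_real_derivative coeff_functional D q) (at t)"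
  unfolding coeff_functional_def
  by (auto intro!: derivative_eq_intros assms simp: mult.commute)

section \<open>Hankel quadratic forms as squares of polynomials\<close>

text \<open>Expanding the square produces exactly the powers \<open>r ^ (i + j)\<close>. The
  hypothesis of the theorem uses \<open>r = X\<close>, \<open>s = 1\<close>, the conclusion
  \<open>r = X - 1\<close>, \<open>s = X\<close>, where \<open>X\<close> is the
  indeterminate.\<close>

lemma hankel_quadratic_form:
  assumes v: "v \<in> carrier_vec n"
    and h: "\<And>k. k \<le> 2 * n - 2 \<Longrightarrow> h k = c * coeff_functional a (r ^ k * s)"
  shows "scalar_prod v (Matrix.mat n n (\<lambda>(i, j). h (i + j)) *\<^sub>v v) =
    c * coeff_functional a ((\<Sum>i<n. Polynomial.smult (vec_index v i) (r ^ i))\<^sup>2 * s)"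
proof -
  have "scalar_prod v (Matrix.mat n n (\<lambda>(i, j). h (i + j)) *\<^sub>v v) =
    (\<Sum>i<n. \<Sum>j<n. vec_index v i * (vec_index v j * h (i + j)))"
    using v by (auto simp: scalar_prod_def atLeast0LessThan sum_distrib_left mult_ac intro!: sum.cong)
  also have "\<dots> = (\<Sum>i<n. \<Sum>j<n. vec_index v i * (vec_index v j * (c * coeff_functional a (r ^ (i + j) * s))))"
    by (intro sum.cong refl) (use h in auto)
  also have "\<dots> = c * coeff_functional a
      (\<Sum>i<n. \<Sum>j<n. Polynomial.smult (vec_index v i * vec_index v j) (r ^ (i + j) * s))"
    by (simp add: coeff_functional_sum coeff_functional_smult sum_distrib_left mult_ac)
  also have "(\<Sum>i<n. \<Sum>j<n. Polynomial.smult (vec_index v i * vec_index v j) (r ^ (i + j) * s)) =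
      (\<Sum>i<n. Polynomial.smult (vec_index v i) (r ^ i))\<^sup>2 * s"
    unfolding power2_eq_square sum_product
    unfolding sum_distrib_right
    by (intro sum.cong refl) (simp add: power_add mult_ac)
  finally show ?thesis .
qed

text \<open>Test the matrix on the coefficient vector of \<open>p\<close>.\<close>

lemma pos_semidef_hankel_imp:
  assumes "pos_semidef (Matrix.mat n n (\<lambda>(i, j). a (i + j)))" and "degree p < n"
  shows "0 \<le> coeff_functional a (p\<^sup>2)"
proof -
  define v where "v = Matrix.vec n (coeff p)"
  have v: "v \<in> carrier_vec n"
    by (simp add: v_def)
  have X: "[:0, 1:] ^ k = monom (1::real) k" for k
    by (simp add: monom_altdef)
  have "p = (\<Sum>i<n. Polynomial.smult (vec_index v i) ([:0, 1:] ^ i))"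
  proof (rule poly_eqI)
    fix k
    show "coeff p k = coeff (\<Sum>i<n. Polynomial.smult (vec_index v i) ([:0, 1:] ^ i)) k"
      using assms(2) coeff_eq_0[of p k]
      by (auto simp: coeff_sum v_def X smult_monom)
  qed
  moreover have "scalar_prod v (Matrix.mat n n (\<lambda>(i, j). a (i + j)) *\<^sub>v v) =
      1 * coeff_functional a ((\<Sum>i<n. Polynomial.smult (vec_index v i) ([:0, 1:] ^ i))\<^sup>2 * 1)"
    by (rule hankel_quadratic_form[OF v]) (simp add: X)
  ultimately show ?thesis
    using assms(1) v by (auto simp: pos_semidef_def)
qed

section \<open>Functions on a half-line unbounded to the left\<close>

text \<open>Mean value theorem. With \<open>c = 0\<close> it gives monotonicity, with
  \<open>c > 0\<close> at least linear decrease towards the left.\<close>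

lemma increment_ge:
  fixes f :: "real \<Rightarrow> real"
  assumes "a \<le> b" and "\<And>t. t \<le> b \<Longrightarrow> (f has_real_derivative f' t) (at t)"
    and "\<And>t. t \<le> b \<Longrightarrow> c \<le> f' t"
  shows "c * (b - a) \<le> f b - f a"
proof (cases "a = b")
  case False
  then have "a < b" using assms(1) by simp
  then obtain z where z: "a < z" "z < b" "f b - f a = (b - a) * f' z"
    using MVT2[of a b f f'] assms(2) by auto
  then show ?thesis
    using assms(3)[of z] \<open>a < b\<close> by (simp add: mult.commute)
qed auto

text \<open>If \<open>u' b < 0\<close>, then \<open>u'\<close> stays below \<open>u' b\<close>
  further left, so \<open>u\<close> lies above a line of negative slope and exceeds every
  bound.\<close>

lemma convex_bounded_imp_deriv_nonneg:
  fixes u :: "real \<Rightarrow> real"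
  assumes "\<And>t. t \<le> b \<Longrightarrow> (u has_real_derivative u' t) (at t)"
    and "\<And>t. t \<le> b \<Longrightarrow> (u' has_real_derivative u'' t) (at t)"
    and "\<And>t. t \<le> b \<Longrightarrow> 0 \<le> u'' t"
    and bdd: "\<And>t. t \<le> b \<Longrightarrow> u t \<le> B"
  shows "0 \<le> u' b"
proof (rule ccontr)
  assume neg: "\<not> 0 \<le> u' b"
  have *: "u' t \<le> u' b" if "t \<le> b" for t
    using increment_ge[of t b u' u'' 0] assms that by auto
  \<comment> \<open>Moving left by \<open>d\<close> forces
    \<open>u (b - d) \<ge> B + 1\<close>.\<close>
  define d where "d = (B - u b + 1) / (- u' b)"
  have "B - u b + 1 > 0" using bdd[of b] by auto
  then have "d > 0" using neg by (auto simp: d_def divide_simps)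
  have "- u' b * (b - (b - d)) \<le> (- u b) - (- u (b - d))"
    by (rule increment_ge[where f = "\<lambda>t. - u t" and f' = "\<lambda>t. - u' t"])
       (use \<open>d > 0\<close> * assms(1) in \<open>auto intro!: derivative_eq_intros\<close>)
  moreover have "- u' b * d = B - u b + 1"
    using neg by (simp add: d_def)
  ultimately show False
    using bdd[of "b - d"] \<open>d > 0\<close> by auto
qed

text \<open>As \<open>w2\<close> is increasing, a negative \<open>w2 b\<close> bounds it on the
  whole half-line. Then \<open>w1\<close> grows to the left and stays above a positive constant, so
  \<open>w0\<close> falls to the left until it is negative.\<close>

lemma third_deriv_nonneg_imp_second_deriv_nonneg:
  fixes w0 :: "real \<Rightarrow> real"
  assumes "\<And>t. t \<le> b \<Longrightarrow> (w0 has_real_derivative w1 t) (at t)"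
    and "\<And>t. t \<le> b \<Longrightarrow> (w1 has_real_derivative w2 t) (at t)"
    and "\<And>t. t \<le> b \<Longrightarrow> (w2 has_real_derivative w3 t) (at t)"
    and "\<And>t. t \<le> b \<Longrightarrow> 0 \<le> w0 t" and "\<And>t. t \<le> b \<Longrightarrow> 0 \<le> w1 t"
    and "\<And>t. t \<le> b \<Longrightarrow> 0 \<le> w3 t"
  shows "0 \<le> w2 b"
proof (rule ccontr)
  assume neg: "\<not> 0 \<le> w2 b"
  have w2: "w2 t \<le> w2 b" if "t \<le> b" for t
    using increment_ge[of t b w2 w3 0] assms that by auto
  \<comment> \<open>One unit to the left of \<open>b\<close>, \<open>w1\<close> has already gained
    \<open>- w2 b > 0\<close>.\<close>
  have w1: "w1 b - w2 b \<le> w1 t" if "t \<le> b - 1" for t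
  proof -
    have "- w2 b * (b - t) \<le> (- w1 b) - (- w1 t)"
      by (rule increment_ge[where f = "\<lambda>t. - w1 t" and f' = "\<lambda>t. - w2 t"])
         (use that w2 assms(2) in \<open>auto intro!: derivative_eq_intros\<close>)
    moreover have "- w2 b * 1 \<le> - w2 b * (b - t)"
      using neg that by (intro mult_left_mono) auto
    ultimately show ?thesis by simp
  qed
  \<comment> \<open>Chosen so that \<open>w0 (b - 1 - d) \<le> -1\<close>.\<close>
  define d where "d = (w0 (b - 1) + 1) / (- w2 b)"
  have "d > 0" using neg assms(4)[of "b - 1"] by (auto simp: d_def divide_simps)
  have "- w2 b * ((b - 1) - (b - 1 - d)) \<le> w0 (b - 1) - w0 (b - 1 - d)"
  proof (rule increment_ge)
    fix t assume t: "t \<le> b - 1"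
    show "- w2 b \<le> w1 t"
      using w1[OF t] assms(5)[of b] by auto
  qed (use \<open>d > 0\<close> assms(1) in auto)
  moreover have "- w2 b * d = w0 (b - 1) + 1"
    using neg by (simp add: d_def)
  ultimately show False
    using assms(4)[of "b - 1 - d"] \<open>d > 0\<close> by auto
qed

section \<open>Positivity of the shifted Hankel form\<close>

text \<open>\<open>G k\<close> plays the role of the \<open>k\<close>-th derivative of
  \<open>g\<close>. The strict bound on \<open>degree p\<close> makes the indeterminate times
  \<open>p\<close> admissible in \<open>psd\<close>.\<close>

lemma shifted_hankel_form_nonneg:
  fixes G :: "nat \<Rightarrow> real \<Rightarrow> real"
  assumes der: "\<And>k t. k < 2 * m \<Longrightarrow> t \<le> b \<Longrightarrow> (G k has_real_derivative G (Suc k) t) (at t)"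
    and psd: "\<And>p t. degree p \<le> m \<Longrightarrow> t \<le> b \<Longrightarrow> 0 \<le> coeff_functional (\<lambda>k. G k t) (p\<^sup>2)"
    and G1: "\<And>t. t \<le> b \<Longrightarrow> 0 \<le> G 1 t"
    and p: "degree p < m"
  shows "0 \<le> coeff_functional (\<lambda>k. G k b) (pCons 0 (p\<^sup>2))"
proof -
  have even: "0 \<le> G (2 * j) t" if "j \<le> m" "t \<le> b" for j t
    using psd[of "monom 1 j" t] that
    by (simp add: degree_monom_eq power2_eq_square mult_monom mult_2)
  \<comment> \<open>Order \<open>2 * j + 3\<close> follows from order \<open>2 * j + 1\<close> and
    the even orders \<open>2 * j + 2\<close> and \<open>2 * j + 4\<close>; the last is at most
    \<open>2 * m\<close>.\<close>
  have odd: "0 \<le> G (2 * j + 1) t" if "j < m" "t \<le> b" for j t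
    using that
  proof (induction j arbitrary: t)
    case 0
    then show ?case using G1 by simp
  next
    case (Suc j)
    show ?case
    proof (rule third_deriv_nonneg_imp_second_deriv_nonneg[where b = t and
          ?w2.0 = "G (2 * Suc j + 1)" and ?w0.0 = "G (2 * j + 1)" and ?w1.0 = "G (2 * Suc j)" and ?w3.0 = "G (2 * Suc (Suc j))"])
      fix s assume s: "s \<le> t"
      show "(G (2 * j + 1) has_real_derivative G (2 * Suc j) s) (at s)"
        using der[of "2 * j + 1" s] s Suc.prems by simp
      show "(G (2 * Suc j) has_real_derivative G (2 * Suc j + 1) s) (at s)"
        using der[of "2 * Suc j" s] s Suc.prems by simp
      show "(G (2 * Suc j + 1) has_real_derivative G (2 * Suc (Suc j)) s) (at s)"
        using der[of "2 * Suc j + 1" s] s Suc.prems by simp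
      show "0 \<le> G (2 * j + 1) s" using Suc s by simp
      show "0 \<le> G (2 * Suc j) s" using Suc.prems s by (intro even) auto
      show "0 \<le> G (2 * Suc (Suc j)) s" using Suc.prems s by (intro even) auto
    qed
  qed
  have nonneg: "0 \<le> G k t" if "k \<le> 2 * m" "t \<le> b" for k t
  proof (cases "even k")
    case True
    then show ?thesis using even[of "k div 2" t] that by auto
  next
    case False
    then obtain j where "k = 2 * j + 1" by (rule oddE)
    then show ?thesis using odd[of j t] that by simp
  qed
  \<comment> \<open>Together with \<open>nonneg\<close>, this bounds \<open>G k\<close> on the whole
    half-line by its value at \<open>b\<close>.\<close>
  have mono: "G k t \<le> G k b" if "k < 2 * m" "t \<le> b" for k t
    using increment_ge[of t b "G k" "G (Suc k)" 0] der nonneg that by auto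
  have deg: "degree (p\<^sup>2) \<le> 2 * m - 2"
    using degree_power_le[of p 2] p by auto
  have deg': "degree (pCons 0 (p\<^sup>2)) < 2 * m"
    using degree_pCons_le[of 0 "p\<^sup>2"] deg p by auto
  let ?u = "\<lambda>q t. coeff_functional (\<lambda>k. G k t) q"
  have der_u: "(?u q has_real_derivative ?u (pCons 0 q) t) (at t)"
    if "degree q < 2 * m" "t \<le> b" for q t
    unfolding coeff_functional_pCons_0
    by (rule has_derivative_coeff_functional) (use der that in auto)
  \<comment> \<open>The second derivative of \<open>?u (p\<^sup>2)\<close> is again the form of a
    square, hence nonnegative.\<close>
  have sq: "pCons 0 (pCons 0 (p\<^sup>2)) = (pCons 0 p)\<^sup>2"
    by (simp add: power2_eq_square)
  show ?thesis
  proof (rule convex_bounded_imp_deriv_nonneg[where u' = "?u (pCons 0 (p\<^sup>2))"])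
    fix t assume t: "t \<le> b"
    show "(?u (p\<^sup>2) has_real_derivative ?u (pCons 0 (p\<^sup>2)) t) (at t)"
      using t deg p by (intro der_u) auto
    show "(?u (pCons 0 (p\<^sup>2)) has_real_derivative ?u (pCons 0 (pCons 0 (p\<^sup>2))) t) (at t)"
      using t deg' by (intro der_u)
    show "0 \<le> ?u (pCons 0 (pCons 0 (p\<^sup>2))) t"
      unfolding sq using t p degree_pCons_le[of 0 p] by (intro psd) auto
    show "?u (p\<^sup>2) t \<le> (\<Sum>k\<le>degree (p\<^sup>2). \<bar>coeff (p\<^sup>2) k\<bar> * G k b)"
      unfolding coeff_functional_def
    proof (rule sum_mono)
      fix k assume "k \<in> {..degree (p\<^sup>2)}"
      then have k: "k < 2 * m" using deg p by auto
      have "coeff (p\<^sup>2) k * G k t \<le> \<bar>coeff (p\<^sup>2) k\<bar> * G k t"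
        using nonneg[of k t] k t by (intro mult_right_mono) auto
      also have "\<dots> \<le> \<bar>coeff (p\<^sup>2) k\<bar> * G k b"
        using mono[OF k t] by (intro mult_left_mono) auto
      finally show "coeff (p\<^sup>2) k * G k t \<le> \<bar>coeff (p\<^sup>2) k\<bar> * G k b" .
    qed
  qed
qed

section \<open>Differentiability of iterated Euler derivatives\<close>

text \<open>Leibniz rule for \<open>x * deriv g x\<close>: two terms survive since the second
  derivative of \<open>x\<close> vanishes. Openness of \<open>S\<close> allows differentiating an
  identity known only on \<open>S\<close>.\<close>

lemma deriv_funpow_euler_deriv:
  assumes "open S" and "\<And>i x. i \<le> n \<Longrightarrow> x \<in> S \<Longrightarrow> (deriv ^^ i) g field_differentiable (at x)"
    and "i \<le> n" and "x \<in> S"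
  shows "(deriv ^^ i) (euler_deriv g) x = x * (deriv ^^ Suc i) g x + real i * (deriv ^^ i) g x"
  using assms(3,4)
proof (induction i arbitrary: x)
  case 0
  then show ?case by (simp add: euler_deriv_def)
next
  case (Suc i)
  have d: "((deriv ^^ j) g has_real_derivative (deriv ^^ Suc j) g x) (at x)" if "j \<le> n" for j
    using assms(2)[OF that \<open>x \<in> S\<close>] by (simp add: DERIV_deriv_iff_field_differentiable)
  have "((\<lambda>x. x * (deriv ^^ Suc i) g x + real i * (deriv ^^ i) g x) has_real_derivative
      x * (deriv ^^ Suc (Suc i)) g x + real (Suc i) * (deriv ^^ Suc i) g x) (at x)"
    by (rule derivative_eq_intros d refl | use Suc.prems in \<open>simp add: algebra_simps\<close>)+
  then have "((deriv ^^ i) (euler_deriv g) has_real_derivative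
      x * (deriv ^^ Suc (Suc i)) g x + real (Suc i) * (deriv ^^ Suc i) g x) (at x)"
    by (rule has_field_derivative_transform_within_open[OF _ \<open>open S\<close> \<open>x \<in> S\<close>])
       (use Suc in auto)
  then show ?case
    by (simp add: DERIV_imp_deriv)
qed

lemma differentiable_deriv_funpow_euler_deriv:
  assumes S: "open S" and g: "\<And>i x. i \<le> n \<Longrightarrow> x \<in> S \<Longrightarrow> (deriv ^^ i) g field_differentiable (at x)"
    and i: "i < n" and x: "x \<in> S"
  shows "(deriv ^^ i) (euler_deriv g) field_differentiable (at x)"
proof -
  have "(\<lambda>x. x * (deriv ^^ Suc i) g x + real i * (deriv ^^ i) g x) field_differentiable (at x)"
    by (intro derivative_intros g x) (use i in auto)
  then obtain D where "((\<lambda>x. x * (deriv ^^ Suc i) g x + real i * (deriv ^^ i) g x) has_field_derivative D) (at x)"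
    by (auto simp: field_differentiable_def)
  then have "((deriv ^^ i) (euler_deriv g) has_field_derivative D) (at x)"
    by (rule has_field_derivative_transform_within_open[OF _ S x])
       (use deriv_funpow_euler_deriv[OF S g] i in auto)
  then show ?thesis
    by (auto simp: field_differentiable_def)
qed

text \<open>Each Euler derivative costs one order of differentiability, so only the total order
  \<open>i + k\<close> counts.\<close>

lemma differentiable_euler_deriv_funpow:
  assumes S: "open S" and f: "\<And>i x. i < n \<Longrightarrow> x \<in> S \<Longrightarrow> (deriv ^^ i) f field_differentiable (at x)"
    and "i + k < n" and "x \<in> S"
  shows "(deriv ^^ i) ((euler_deriv ^^ k) f) field_differentiable (at x)"
  using assms(3,4)
proof (induction k arbitrary: i x)
  case 0
  then show ?case using f by simp
next
  case (Suc k)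
  show ?case
    unfolding funpow.simps o_apply
    by (rule differentiable_deriv_funpow_euler_deriv[OF S, where n = "Suc i"])
       (use Suc in auto)
qed

section \<open>Transfer to the Euler-Hankel matrices\<close>

theorem theorem3p2:
  fixes m :: nat and \<rho> :: ereal and f :: "real \<Rightarrow> real"
  assumes "m \<ge> 2"
    and "0 < \<rho>"
    and "C_k_on (2 * m) f (einterval 0 \<rho>)"
    and "\<forall>x \<in> einterval 0 \<rho>. 0 \<le> f x"
    and "\<forall>x \<in> einterval 0 \<rho>. 0 \<le> deriv f x"
    and "\<forall>x \<in> einterval 0 \<rho>. 0 \<le> deriv (deriv f) x"
    and "\<forall>x \<in> einterval 0 \<rho>. pos_semidef (euler_hankel (m + 1) f x)"
  shows "\<forall>x \<in> einterval 0 \<rho>. pos_semidef (euler_hankel m (deriv f) x)"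
proof
  define S where "S = einterval 0 \<rho>"
  define e where "e k = (euler_deriv ^^ k) f" for k
  have S: "open S" by (simp add: S_def)
  have pos: "0 < x" if "x \<in> S" for x
    using that by (simp add: S_def einterval_def)
  \<comment> \<open>Hence \<open>exp\<close> maps the whole half-line left of \<open>ln x\<close>
    into \<open>S\<close>.\<close>
  have down: "y \<in> S" if "x \<in> S" "0 < y" "y \<le> x" for x y
    using that le_less_trans[of "ereal y" "ereal x" \<rho>] by (simp add: S_def einterval_def)
  have f: "(deriv ^^ i) f field_differentiable (at x)" if "i < 2 * m" "x \<in> S" for i x
    using assms(3) that by (auto simp: C_k_on_def S_def)
  have e: "(e k has_real_derivative e (Suc k) x / x) (at x)" if "k < 2 * m" "x \<in> S" for k x
    using differentiable_euler_deriv_funpow[where i = 0 and k = k, OF S f] that pos[of x]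
    by (simp add: e_def euler_deriv_def DERIV_deriv_iff_field_differentiable)
  let ?L = "\<lambda>x. coeff_functional (\<lambda>k. e k x)"
  \<comment> \<open>Write \<open>E\<close> for the Euler derivative. Since
    \<open>f' = E f / x\<close> and \<open>E (y / x) = (E y - y) / x\<close>, each further
    \<open>E\<close> contributes a factor \<open>E - 1\<close>. The largest index in an
    \<open>m\<close> by \<open>m\<close> Hankel matrix is \<open>2 * m - 2\<close>.\<close>
  have h: "(euler_deriv ^^ k) (deriv f) x = inverse x * ?L x ([:-1, 1:] ^ k * [:0, 1:])"
    if "k \<le> 2 * m - 2" "x \<in> S" for k x
    using that
  proof (induction k arbitrary: x)
    case 0
    have "[:0, 1:] = monom (1::real) 1" by (simp add: monom_altdef)
    then show ?case using pos[OF 0(2)] by (simp add: e_def euler_deriv_def)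
  next
    case (Suc k)
    let ?q = "[:-1, 1:] ^ k * [:0, 1:] :: real poly"
    have x: "x > 0" using pos Suc.prems by simp
    have deg: "degree ?q \<le> Suc k"
      using degree_mult_le[of "[:-1, 1:] ^ k" "[:0, 1:] :: real poly"]
        degree_power_le[of "[:-1, 1:] :: real poly" k] by simp
    have "((\<lambda>x. ?L x ?q) has_real_derivative coeff_functional (\<lambda>k. e (Suc k) x / x) ?q) (at x)"
      by (rule has_derivative_coeff_functional) (use deg Suc.prems in \<open>auto intro!: e\<close>)
    also have "coeff_functional (\<lambda>k. e (Suc k) x / x) ?q = ?L x (pCons 0 ?q) / x"
      unfolding coeff_functional_pCons_0
      by (simp only: coeff_functional_def sum_divide_distrib times_divide_eq_right)
    finally have "((\<lambda>x. inverse x * ?L x ?q) has_real_derivative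
        (?L x (pCons 0 ?q) - ?L x ?q) / x\<^sup>2) (at x)"
      using x by (auto intro!: derivative_eq_intros simp: field_simps power2_eq_square)
    also have "?L x (pCons 0 ?q) - ?L x ?q = ?L x ([:-1, 1:] ^ Suc k * [:0, 1:])"
      by (simp flip: coeff_functional_diff)
    finally have "((euler_deriv ^^ k) (deriv f) has_real_derivative
        ?L x ([:-1, 1:] ^ Suc k * [:0, 1:]) / x\<^sup>2) (at x)"
      by (rule has_field_derivative_transform_within_open[OF _ S Suc.prems(2)])
         (use Suc in auto)
    then have "deriv ((euler_deriv ^^ k) (deriv f)) x = ?L x ([:-1, 1:] ^ Suc k * [:0, 1:]) / x\<^sup>2"
      by (rule DERIV_imp_deriv)
    moreover have "(euler_deriv ^^ Suc k) (deriv f) x = x * deriv ((euler_deriv ^^ k) (deriv f)) x"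
      unfolding funpow.simps o_apply by (subst euler_deriv_def) simp
    ultimately show ?case
      using x by (simp add: field_simps power2_eq_square)
  qed

  fix x assume "x \<in> einterval 0 \<rho>"
  then have x: "x \<in> S" by (simp add: S_def)
  have expS: "exp t \<in> S" if "t \<le> ln x" for t
    using down[OF x, of "exp t"] that pos[OF x] by (simp add: ln_ge_iff)
  \<comment> \<open>Substitute \<open>x = exp t\<close>: the chain rule turns \<open>e k\<close>
    into the \<open>k\<close>-th derivative in \<open>t\<close>.\<close>
  have key: "0 \<le> ?L x (pCons 0 (p\<^sup>2))" if "degree p < m" for p
  proof -
    have "0 \<le> coeff_functional (\<lambda>k. e k (exp (ln x))) (pCons 0 (p\<^sup>2))"
    proof (rule shifted_hankel_form_nonneg[where G = "\<lambda>k t. e k (exp t)", OF _ _ _ that])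
      fix k t assume k: "k < 2 * m" and t: "t \<le> ln x"
      show "((\<lambda>t. e k (exp t)) has_real_derivative e (Suc k) (exp t)) (at t)"
        using DERIV_chain2[OF e[OF k expS[OF t]] DERIV_exp] by simp
    next
      fix p :: "real poly" and t assume p: "degree p \<le> m" and t: "t \<le> ln x"
      have "pos_semidef (euler_hankel (m + 1) f (exp t))"
        using assms(7) expS[OF t] by (simp add: S_def)
      then show "0 \<le> coeff_functional (\<lambda>k. e k (exp t)) (p\<^sup>2)"
        unfolding euler_hankel_def e_def by (rule pos_semidef_hankel_imp) (use p in simp)
    next
      fix t assume t: "t \<le> ln x"
      show "0 \<le> e 1 (exp t)"
        using assms(5) expS[OF t] by (simp add: e_def euler_deriv_def S_def)
    qed
    then show ?thesis using pos[OF x] by simp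
  qed
  show "pos_semidef (euler_hankel m (deriv f) x)"
    unfolding pos_semidef_def
  proof (intro conjI ballI)
    show "transpose_mat (euler_hankel m (deriv f) x) = euler_hankel m (deriv f) x"
      by (rule eq_matI) (auto simp: euler_hankel_def add.commute)
  next
    fix v :: "real Matrix.vec"
    assume "v \<in> carrier_vec (dim_row (euler_hankel m (deriv f) x))"
    then have v: "v \<in> carrier_vec m" by (simp add: euler_hankel_def)
    \<comment> \<open>Powers of \<open>X - 1\<close> appear because of \<open>h\<close>; the
      remaining factor \<open>X\<close> is the shift in \<open>key\<close>.\<close>
    define p where "p = (\<Sum>i<m. Polynomial.smult (vec_index v i) ([:-1, 1:] ^ i))"
    have "scalar_prod v (euler_hankel m (deriv f) x *\<^sub>v v) =
        inverse x * ?L x (p\<^sup>2 * [:0, 1:])"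
      unfolding euler_hankel_def p_def by (rule hankel_quadratic_form[OF v h[OF _ x]])
    moreover have "degree p \<le> m - 1"
      unfolding p_def
    proof (rule degree_sum_le)
      fix i assume "i \<in> {..<m}"
      then show "degree (Polynomial.smult (vec_index v i) ([:-1, 1:] ^ i)) \<le> m - 1"
        using degree_smult_le[of "vec_index v i" "[:-1, 1:] ^ i"]
          degree_power_le[of "[:-1, 1:] :: real poly" i] by auto
    qed simp
    ultimately show "0 \<le> scalar_prod v (euler_hankel m (deriv f) x *\<^sub>v v)"
      using key[of p] pos[OF x] assms(1) by simp
  qed
qed

end
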